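(* If $X$ is a path-connected Hausdorff space with basepoint $e$, then the inclusion of generators $\sigma:X\to J(X)$ induces a surjection $\sigma_\#:\pi_1(X,e)\to\pi_1(J(X),e)$.
   Context: The James reduced product of a based space $(X,e)$ is $J(X)=\coprod_{n\in\mathbb{N}}X^n/\sim$ where $\sim$ is generated by $(x_1,\dots,x_{j-1},e,x_{j+1},\dots,x_n)\sim(x_1,\dots,x_{j-1},x_{j+1},\dots,x_n)$; elements are finite words in $X\setminus\{e\}$ (the empty word is identified with $e$), and the monoid operation is word concatenation. Topology: $X^n$ has the product topology, $J_n(X)$ (words of length $\leq n$) has the quotient topology from $q_n:X^n\to J_n(X)$, and $J(X)$ has the weak topology with respect to $\{J_n(X)\}$ (a set is closed iff its intersection with each $J_n(X)$ is closed). $\sigma:X\to J(X)$ sends $x$ to the one-letter word $x$. *)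

theory Defs
  imports "HOL-Analysis.Analysis"
begin

text \<open>Words: finite lists of letters from X minus the basepoint e.
  The empty word [] represents (the class of) e.\<close>
definition james_words :: "'a topology \<Rightarrow> 'a \<Rightarrow> 'a list set" where
  "james_words X e = {w. set w \<subseteq> topspace X - {e}}"

definition power_top :: "'a topology \<Rightarrow> nat \<Rightarrow> (nat \<Rightarrow> 'a) topology" where
  "power_top X n = product_topology (\<lambda>i. X) {..<n}"

definition james_q :: "'a \<Rightarrow> nat \<Rightarrow> (nat \<Rightarrow> 'a) \<Rightarrow> 'a list" where
  "james_q e n f = filter (\<lambda>x. x \<noteq> e) (map f [0..<n])"

definition james_Jn_set :: "'a topology \<Rightarrow> 'a \<Rightarrow> nat \<Rightarrow> 'a list set" where
  "james_Jn_set X e n = {w \<in> james_words X e. length w \<le> n}"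

definition james_Jn :: "'a topology \<Rightarrow> 'a \<Rightarrow> nat \<Rightarrow> 'a list topology" where
  "james_Jn X e n = topology (\<lambda>U. U \<subseteq> james_Jn_set X e n \<and>
      openin (power_top X n) {f \<in> topspace (power_top X n). james_q e n f \<in> U})"

definition james :: "'a topology \<Rightarrow> 'a \<Rightarrow> 'a list topology" where
  "james X e = topology (\<lambda>U. U \<subseteq> james_words X e \<and>
      (\<forall>n. closedin (james_Jn X e n) ((james_words X e - U) \<inter> james_Jn_set X e n)))"

definition james_sigma :: "'a \<Rightarrow> 'a \<Rightarrow> 'a list" where
  "james_sigma e x = (if x = e then [] else [x])"

definition loopin :: "'a topology \<Rightarrow> 'a \<Rightarrow> (real \<Rightarrow> 'a) \<Rightarrow> bool" where
  "loopin X a g \<longleftrightarrow> pathin X g \<and> g 0 = a \<and> g 1 = a"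

definition path_homotopic :: "'a topology \<Rightarrow> (real \<Rightarrow> 'a) \<Rightarrow> (real \<Rightarrow> 'a) \<Rightarrow> bool" where
  "path_homotopic X g h \<longleftrightarrow>
     homotopic_with (\<lambda>k. k 0 = g 0 \<and> k 1 = g 1) (top_of_set {0..1}) X g h"

definition pi1 :: "'a topology \<Rightarrow> 'a \<Rightarrow> (real \<Rightarrow> 'a) set set" where
  "pi1 X a = {{h. loopin X a h \<and> path_homotopic X g h} | g. loopin X a g}"

definition pi1_map :: "'b topology \<Rightarrow> ('a \<Rightarrow> 'b) \<Rightarrow> 'a \<Rightarrow>
     (real \<Rightarrow> 'a) set \<Rightarrow> (real \<Rightarrow> 'b) set" where
  "pi1_map Y f a c = {h. loopin Y (f a) h \<and> (\<exists>g\<in>c. path_homotopic Y (f \<circ> g) h)}"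

end

theory Submission
  imports Defs
begin

text \<open>
  Follow the letters of a loop \<open>w\<close> in \<open>J(X)\<close> through time. A letter is born from \<open>e\<close>, moves
  continuously in \<open>X\<close>, and finally dies at \<open>e\<close>, so that every ``life'' is a loop in \<open>X\<close> based at \<open>e\<close>.
  By compactness \<open>w\<close> has words of bounded length, and for every neighbourhood of \<open>e\<close> all but finitely
  many lives stay inside it. Hence retiming the lives independently of each other yields again a
  continuous loop in \<open>J(X)\<close>, and the retiming can be performed as a homotopy.

  On the time span of a life, the word length attains its maximum, and near such a time no letter is
  born or dies, so only finitely many lives are present there. This leaves room to choose, for every life,
  an open interval inside its span such that the intervals of different lives are disjoint. Retiming
  each life to take place entirely within its interval leaves at most one letter at any time,
  which is a loop of the form \<open>\<sigma> \<circ> b\<close>.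
\<close>

section \<open>The topology of the James construction\<close>

text \<open>\<open>fits U [V\<^sub>1, \<dots>, V\<^sub>k] v\<close> says that \<open>v\<close> matches the regular expression
  \<open>U\<^sup>* V\<^sub>1 U\<^sup>* \<dots> V\<^sub>k U\<^sup>*\<close>. For \<open>U\<close> a neighbourhood of \<open>e\<close> and \<open>V\<^sub>i\<close> a neighbourhood of \<open>x\<^sub>i\<close>,
  these sets form a neighbourhood basis of \<open>x\<^sub>1 \<dots> x\<^sub>k\<close> among the words of bounded length.\<close>

inductive fits :: "'a set \<Rightarrow> 'a set list \<Rightarrow> 'a list \<Rightarrow> bool" for U where
  fits_Nil: "fits U [] []"
| fits_skip: "a \<in> U \<Longrightarrow> fits U Vs v \<Longrightarrow> fits U Vs (a # v)"
| fits_match: "a \<in> V \<Longrightarrow> fits U Vs v \<Longrightarrow> fits U (V # Vs) (a # v)"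

lemma fits_Nil_iff [simp]: "fits U Vs [] \<longleftrightarrow> Vs = []"
  using fits.simps[of U Vs "[]"] by simp

lemma fits_filter:
  assumes "fits U Vs v" "\<And>V. V \<in> set Vs \<Longrightarrow> e \<notin> V"
  shows "fits U Vs (filter (\<lambda>x. x \<noteq> e) v)"
  using assms by (induction) (auto simp: fits.intros)

lemma fits_unfilter:
  assumes "fits U Vs (filter (\<lambda>x. x \<noteq> e) v)" "e \<in> U"
  shows "fits U Vs v"
  using assms
proof (induction v arbitrary: Vs)
  case (Cons a v)
  show ?case
  proof (cases "a = e")
    case True
    then show ?thesis using Cons by (auto intro: fits_skip)
  next
    case False
    then have "fits U Vs (a # filter (\<lambda>x. x \<noteq> e) v)" using Cons.prems by simp
    then show ?thesis using Cons.IH \<open>e \<in> U\<close>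
      by cases (auto simp: fits.intros)
  qed
qed simp

lemma fits_append_replicate:
  assumes "fits U Vs v" "e \<in> U"
  shows "fits U Vs (v @ replicate k e)"
proof -
  have "fits U [] (replicate k e)" using assms(2) by (induction k) (auto simp: fits.intros)
  with assms(1) show ?thesis by induction (auto simp: fits.intros)
qed

lemma fits_map_filterI:
  assumes "list_all2 (\<in>) (map h (filter P l)) Vs"
    and "\<And>x. x \<in> set l \<Longrightarrow> \<not> P x \<Longrightarrow> h x \<in> U"
  shows "fits U Vs (map h l)"
  using assms
proof (induction l arbitrary: Vs)
  case (Cons x l)
  show ?case
  proof (cases "P x")
    case True
    then obtain V Vs' where "Vs = V # Vs'" "h x \<in> V" "list_all2 (\<in>) (map h (filter P l)) Vs'"
      using Cons.prems(1) by (auto simp: list_all2_Cons1)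
    then show ?thesis using Cons by (simp add: fits_match)
  next
    case False
    then show ?thesis using Cons by (simp add: fits_skip)
  qed
qed (simp add: fits_Nil)

lemma fits_map:
  assumes "fits A (map B l) v"
    and "\<And>a. a \<in> A \<Longrightarrow> a \<in> set v \<Longrightarrow> h a \<in> U"
    and "\<And>a b. b \<in> set l \<Longrightarrow> a \<in> B b \<Longrightarrow> h a \<in> V b"
  shows "fits U (map V l) (map h v)"
  using assms
proof (induction "map B l" v arbitrary: l rule: fits.induct)
  case (fits_match a C Cs v)
  then obtain b l' where l: "l = b # l'" "C = B b" "Cs = map B l'" by auto
  then have "fits U (map V l') (map h v)" using fits_match by auto
  moreover have "h a \<in> V b" using fits_match l by auto
  ultimately show ?case using l by (auto intro: fits.fits_match)
qed (auto simp: fits.intros)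

lemma fits_list_all2_filter:
  assumes "fits U Vs v" "\<And>V. V \<in> set Vs \<Longrightarrow> V \<inter> U = {}"
  shows "list_all2 (\<in>) (filter (\<lambda>x. x \<notin> U) v) Vs"
  using assms
proof induction
  case (fits_match a V Vs v)
  have "a \<notin> U" using fits_match.hyps(1) fits_match.prems[of V] by auto
  then show ?case using fits_match by simp
qed simp_all

lemma fits_letter:
  assumes "fits U Vs v" "a \<in> set v"
  shows "a \<in> U \<or> (\<exists>V\<in>set Vs. a \<in> V)"
  using assms by induction auto

lemma fits_pattern:
  assumes "fits (G e) (map G x) v"
  obtains z where "fits {e} (map (\<lambda>a. {a}) x) z" "list_all2 (\<lambda>a b. a \<in> G b) v z"
proof -
  have "\<exists>z. fits {e} (map (\<lambda>a. {a}) x) z \<and> list_all2 (\<lambda>a b. a \<in> G b) v z"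
    using assms
  proof (induction "map G x" v arbitrary: x rule: fits.induct)
    case fits_Nil
    then show ?case by (auto simp: fits.intros)
  next
    case (fits_skip a v)
    then show ?case
      by (metis fits.fits_skip insertI1 list_all2_Cons)
  next
    case (fits_match a V Vs v)
    then obtain b x' where x: "x = b # x'" "V = G b" "Vs = map G x'" by auto
    with fits_match obtain z where "fits {e} (map (\<lambda>a. {a}) x') z" "list_all2 (\<lambda>a b. a \<in> G b) v z"
      by blast
    then have "fits {e} (map (\<lambda>a. {a}) x) (b # z)" "list_all2 (\<lambda>a b. a \<in> G b) (a # v) (b # z)"
      using x fits_match by (auto simp: fits.intros)
    then show ?case by blast
  qed
  then show ?thesis using that by blast
qed

lemma fits_singletons_filter:
  assumes "fits {e} (map (\<lambda>a. {a}) x) z"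
  shows "filter (\<lambda>a. a \<noteq> e) z = filter (\<lambda>a. a \<noteq> e) x"
  using assms
proof (induction "map (\<lambda>a. {a}) x" z arbitrary: x rule: fits.induct)
  case (fits_match a V Vs v)
  then obtain b x' where "x = b # x'" "V = {b}" "Vs = map (\<lambda>a. {a}) x'" by auto
  then show ?case using fits_match by simp
qed simp_all

lemma fits_box:
  assumes "fits U Vs v"
  obtains Bs where "list_all2 (\<in>) v Bs" "set Bs \<subseteq> insert U (set Vs)"
    "\<And>v'. list_all2 (\<in>) v' Bs \<Longrightarrow> fits U Vs v'"
proof -
  have "\<exists>Bs. list_all2 (\<in>) v Bs \<and> set Bs \<subseteq> insert U (set Vs)
      \<and> (\<forall>v'. list_all2 (\<in>) v' Bs \<longrightarrow> fits U Vs v')"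
    using assms
  proof induction
    case fits_Nil
    show ?case by (auto simp: fits.intros)
  next
    case (fits_skip a Vs v)
    then obtain Bs where "list_all2 (\<in>) v Bs" "set Bs \<subseteq> insert U (set Vs)"
        "\<forall>v'. list_all2 (\<in>) v' Bs \<longrightarrow> fits U Vs v'" by blast
    with fits_skip(1) show ?case
      by (intro exI[of _ "U # Bs"]) (auto simp: list_all2_Cons2 fits.intros)
  next
    case (fits_match a V Vs v)
    then obtain Bs where "list_all2 (\<in>) v Bs" "set Bs \<subseteq> insert U (set Vs)"
        "\<forall>v'. list_all2 (\<in>) v' Bs \<longrightarrow> fits U Vs v'" by blast
    with fits_match(1) show ?case
      by (intro exI[of _ "V # Bs"]) (auto simp: list_all2_Cons2 fits.intros)
  qed
  then show ?thesis using that by blast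
qed

lemma topspace_power_top: "topspace (power_top X n) = ({..<n} \<rightarrow>\<^sub>E topspace X)"
  by (simp add: power_top_def)

lemma james_q_in_Jn_set:
  assumes "f \<in> topspace (power_top X n)"
  shows "james_q e n f \<in> james_Jn_set X e n"
proof -
  have "f i \<in> topspace X" if "i < n" for i
    using assms that unfolding topspace_power_top by (rule PiE_mem[OF _ lessThan_iff[THEN iffD2]])
  moreover have "length (james_q e n f) \<le> n"
    unfolding james_q_def by (rule order.trans[OF length_filter_le]) simp
  ultimately show ?thesis
    by (auto simp: james_Jn_set_def james_words_def james_q_def)
qed

lemma openin_james_Jn:
  "openin (james_Jn X e n) U \<longleftrightarrow> U \<subseteq> james_Jn_set X e n \<and>
     openin (power_top X n) {f \<in> topspace (power_top X n). james_q e n f \<in> U}"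
proof -
  let ?Q = "\<lambda>U. {f \<in> topspace (power_top X n). james_q e n f \<in> U}"
  have "istopology (\<lambda>U. U \<subseteq> james_Jn_set X e n \<and> openin (power_top X n) (?Q U))"
    unfolding istopology_def
  proof (intro conjI allI impI)
    fix S T
    assume "S \<subseteq> james_Jn_set X e n \<and> openin (power_top X n) (?Q S)"
      and "T \<subseteq> james_Jn_set X e n \<and> openin (power_top X n) (?Q T)"
    moreover have "?Q (S \<inter> T) = ?Q S \<inter> ?Q T" by auto
    ultimately show "S \<inter> T \<subseteq> james_Jn_set X e n" "openin (power_top X n) (?Q (S \<inter> T))"
      by auto
  next
    fix \<K>
    assume *: "\<forall>K\<in>\<K>. K \<subseteq> james_Jn_set X e n \<and> openin (power_top X n) (?Q K)"
    moreover have "?Q (\<Union>\<K>) = (\<Union>K\<in>\<K>. ?Q K)" by auto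
    ultimately show "\<Union>\<K> \<subseteq> james_Jn_set X e n" "openin (power_top X n) (?Q (\<Union>\<K>))"
      by (auto intro!: openin_Union)
  qed
  then show ?thesis by (simp add: james_Jn_def topology_inverse')
qed

lemma topspace_james_Jn: "topspace (james_Jn X e n) = james_Jn_set X e n"
proof -
  have "{f \<in> topspace (power_top X n). james_q e n f \<in> james_Jn_set X e n} = topspace (power_top X n)"
    by (auto simp: james_q_in_Jn_set)
  then have "openin (james_Jn X e n) (james_Jn_set X e n)"
    by (simp add: openin_james_Jn)
  then show ?thesis
    by (metis openin_james_Jn openin_subset openin_topspace subset_antisym)
qed

lemma openin_james:
  "openin (james X e) U \<longleftrightarrow> U \<subseteq> james_words X e \<and>
     (\<forall>n. openin (power_top X n) {f \<in> topspace (power_top X n). james_q e n f \<in> U})"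
proof -
  let ?P = "\<lambda>U. U \<subseteq> james_words X e \<and>
      (\<forall>n. closedin (james_Jn X e n) ((james_words X e - U) \<inter> james_Jn_set X e n))"
  let ?R = "\<lambda>U. U \<subseteq> james_words X e \<and>
      (\<forall>n. openin (power_top X n) {f \<in> topspace (power_top X n). james_q e n f \<in> U})"
  have PR: "?P U = ?R U" for U
  proof (rule conj_cong[OF refl], rule all_cong1)
    fix n
    assume "U \<subseteq> james_words X e"
    have "james_Jn_set X e n - (james_words X e - U) \<inter> james_Jn_set X e n = U \<inter> james_Jn_set X e n"
      by (auto simp: james_Jn_set_def)
    moreover have "{f \<in> topspace (power_top X n). james_q e n f \<in> U \<inter> james_Jn_set X e n}
        = {f \<in> topspace (power_top X n). james_q e n f \<in> U}"
      by (auto simp: james_q_in_Jn_set)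
    ultimately show "closedin (james_Jn X e n) ((james_words X e - U) \<inter> james_Jn_set X e n)
       = openin (power_top X n) {f \<in> topspace (power_top X n). james_q e n f \<in> U}"
      by (simp add: closedin_def topspace_james_Jn openin_james_Jn)
  qed
  have "istopology ?R"
    unfolding istopology_def
  proof (intro conjI allI impI)
    fix S T n
    assume "?R S" and "?R T"
    moreover have "{f \<in> topspace (power_top X n). james_q e n f \<in> S \<inter> T}
        = {f \<in> topspace (power_top X n). james_q e n f \<in> S} \<inter>
          {f \<in> topspace (power_top X n). james_q e n f \<in> T}" by auto
    ultimately show "S \<inter> T \<subseteq> james_words X e"
      "openin (power_top X n) {f \<in> topspace (power_top X n). james_q e n f \<in> S \<inter> T}"
      by auto
  next
    fix \<K> n
    assume "\<forall>K\<in>\<K>. ?R K"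
    moreover have "{f \<in> topspace (power_top X n). james_q e n f \<in> \<Union>\<K>}
        = (\<Union>K\<in>\<K>. {f \<in> topspace (power_top X n). james_q e n f \<in> K})" by auto
    ultimately show "\<Union>\<K> \<subseteq> james_words X e"
      "openin (power_top X n) {f \<in> topspace (power_top X n). james_q e n f \<in> \<Union>\<K>}"
      by (auto intro!: openin_Union)
  qed
  then show ?thesis by (simp add: james_def PR topology_inverse')
qed

lemma topspace_james: "topspace (james X e) = james_words X e"
proof -
  have "{f \<in> topspace (power_top X n). james_q e n f \<in> james_words X e} = topspace (power_top X n)" for n
    using james_q_in_Jn_set by (fastforce simp: james_Jn_set_def)
  then have "openin (james X e) (james_words X e)"
    by (simp add: openin_james)
  then show ?thesis
    by (metis openin_james openin_subset openin_topspace subset_antisym)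
qed

lemma openin_james_fits:
  assumes "openin X U" "e \<in> U" "\<And>V. V \<in> set Vs \<Longrightarrow> openin X V \<and> e \<notin> V"
  shows "openin (james X e) {v \<in> james_words X e. fits U Vs v}"
  unfolding openin_james
proof (intro conjI allI)
  fix n
  let ?S = "{f \<in> topspace (power_top X n). james_q e n f \<in> {v \<in> james_words X e. fits U Vs v}}"
  have fits_iff: "fits U Vs (james_q e n f) \<longleftrightarrow> fits U Vs (map f [0..<n])" for f
    unfolding james_q_def using assms fits_filter fits_unfilter by metis
  show "openin (power_top X n) ?S"
  proof (subst openin_subopen, intro ballI)
    fix f assume f: "f \<in> ?S"
    then have "fits U Vs (map f [0..<n])" by (simp add: fits_iff)
    then obtain Bs where Bs: "list_all2 (\<in>) (map f [0..<n]) Bs" "set Bs \<subseteq> insert U (set Vs)"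
      "\<And>v'. list_all2 (\<in>) v' Bs \<Longrightarrow> fits U Vs v'" by (rule fits_box) blast
    have len: "length Bs = n" using Bs(1) by (auto dest: list_all2_lengthD)
    let ?T = "\<Pi>\<^sub>E i\<in>{..<n}. Bs ! i"
    have op: "openin X (Bs ! i)" if "i < n" for i
      using Bs(2) assms len that nth_mem[of i Bs] by fastforce
    have "openin (power_top X n) ?T"
      unfolding power_top_def by (simp add: openin_PiE op)
    moreover have "f \<in> ?T"
      using f Bs(1) by (auto simp: topspace_power_top list_all2_conv_all_nth PiE_iff)
    moreover have "?T \<subseteq> ?S"
    proof
      fix h assume h: "h \<in> ?T"
      then have ht: "h \<in> topspace (power_top X n)"
        using op openin_subset by (fastforce simp: topspace_power_top PiE_iff)
      have "list_all2 (\<in>) (map h [0..<n]) Bs"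
        using h len by (auto simp: list_all2_conv_all_nth PiE_iff)
      then show "h \<in> ?S"
        using Bs(3) ht james_q_in_Jn_set[OF ht, of e] by (auto simp: fits_iff james_Jn_set_def)
    qed
    ultimately show "\<exists>T. openin (power_top X n) T \<and> f \<in> T \<and> T \<subseteq> ?S" by blast
  qed
qed blast

lemma james_nhd_fits:
  assumes W: "openin (james X e) W" and e: "e \<in> topspace X"
    and x: "set x \<subseteq> topspace X" "length x \<le> n" "filter (\<lambda>a. a \<noteq> e) x \<in> W"
  obtains G where "\<And>a. a \<in> insert e (set x) \<Longrightarrow> openin X (G a) \<and> a \<in> G a"
    and "\<And>v. length v \<le> n \<Longrightarrow> fits (G e) (map G x) v \<Longrightarrow> filter (\<lambda>a. a \<noteq> e) v \<in> W"
proof -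
  define Z where "Z = {z. (set z \<subseteq> insert e (set x) \<and> length z = n) \<and>
    filter (\<lambda>a. a \<noteq> e) z = filter (\<lambda>a. a \<noteq> e) x}"
  let ?S = "{f \<in> topspace (power_top X n). james_q e n f \<in> W}"
  have fin: "finite Z" 
    unfolding Z_def by (rule finite_subset[OF _ finite_lists_length_eq[of "insert e (set x)" n]]) auto
  have opS: "openin (power_top X n) ?S" using W by (simp add: openin_james)
  have "\<exists>B. (\<forall>i<n. openin X (B i) \<and> z ! i \<in> B i) \<and> (\<Pi>\<^sub>E i\<in>{..<n}. B i) \<subseteq> ?S" if "z \<in> Z" for z
  proof -
    let ?f = "restrict (nth z) {..<n}"
    have z: "set z \<subseteq> insert e (set x)" "length z = n" using that by (auto simp: Z_def)
    have "z ! i \<in> topspace X" if "i < n" for i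
      using z x e that nth_mem[of i z] by blast
    then have "?f \<in> topspace (power_top X n)"
      by (auto simp: topspace_power_top)
    moreover have "map ?f [0..<n] = z" using z by (auto intro: nth_equalityI)
    ultimately have "?f \<in> ?S" using that x by (auto simp: james_q_def Z_def)
    then obtain B where "finite {i \<in> {..<n}. B i \<noteq> topspace X}" "\<forall>i\<in>{..<n}. openin X (B i)"
      "?f \<in> Pi\<^sub>E {..<n} B" "Pi\<^sub>E {..<n} B \<subseteq> ?S"
      using opS unfolding power_top_def openin_product_topology_alt by meson
    then show ?thesis by (intro exI[of _ B]) (auto simp: PiE_iff)
  qed
  then have "\<forall>z\<in>Z. \<exists>B. (\<forall>i<n. openin X (B i) \<and> z ! i \<in> B i) \<and> (\<Pi>\<^sub>E i\<in>{..<n}. B i) \<subseteq> ?S"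
    by (rule ballI)
  from bchoice[OF this] obtain B where
    B0: "\<forall>z\<in>Z. (\<forall>i<n. openin X (B z i) \<and> z ! i \<in> B z i) \<and> (\<Pi>\<^sub>E i\<in>{..<n}. B z i) \<subseteq> ?S" ..
  have B: "openin X (B z i) \<and> z ! i \<in> B z i" if "z \<in> Z" "i < n" for z i
    using bspec[OF B0 that(1)] that(2) by simp
  have BS: "(\<Pi>\<^sub>E i\<in>{..<n}. B z i) \<subseteq> ?S" if "z \<in> Z" for z
    using bspec[OF B0 that] by (rule conjunct2)
  define G where "G a = topspace X \<inter> (\<Inter>(z,i)\<in>{(z,i). z \<in> Z \<and> i < n \<and> z ! i = a}. B z i)" for a
  show thesis
  proof (rule that)
    fix a assume a: "a \<in> insert e (set x)"
    have "finite (Z \<times> {..<n})" using fin by blast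
    then have "finite {(z,i). z \<in> Z \<and> i < n \<and> z ! i = a}"
      by (rule rev_finite_subset) auto
    then have "openin X (G a)" unfolding G_def
      by (intro openin_Int_Inter) (use B in auto)
    moreover have "a \<in> G a" using B a x e unfolding G_def by auto
    ultimately show "openin X (G a) \<and> a \<in> G a" by blast
  next
    fix v assume v: "length v \<le> n" "fits (G e) (map G x) v"
    have "e \<in> G e" using B e unfolding G_def by auto
    define v' where "v' = v @ replicate (n - length v) e"
    have "fits (G e) (map G x) v'"
      unfolding v'_def using v \<open>e \<in> G e\<close> by (intro fits_append_replicate)
    then obtain z where z: "fits {e} (map (\<lambda>a. {a}) x) z" "list_all2 (\<lambda>a b. a \<in> G b) v' z"
      by (rule fits_pattern)
    have lv: "length v' = n" using v by (simp add: v'_def)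
    have lz: "length z = n" using z lv by (auto dest: list_all2_lengthD)
    have zZ: "z \<in> Z"
      using lz fits_singletons_filter[OF z(1)] fits_letter[OF z(1)] by (auto simp: Z_def)
    let ?f = "restrict (nth v') {..<n}"
    have "v' ! i \<in> B z i" if "i < n" for i
    proof -
      have "v' ! i \<in> G (z ! i)" using z(2) lv that by (auto simp: list_all2_conv_all_nth)
      then show ?thesis using zZ that unfolding G_def by blast
    qed
    then have "?f \<in> (\<Pi>\<^sub>E i\<in>{..<n}. B z i)" by auto
    then have "?f \<in> ?S" using BS[OF zZ] by (rule subsetD[rotated])
    moreover have "map ?f [0..<n] = v'" using lv by (auto intro: nth_equalityI)
    ultimately have "filter (\<lambda>a. a \<noteq> e) v' \<in> W" by (auto simp: james_q_def)
    then show "filter (\<lambda>a. a \<noteq> e) v \<in> W" by (simp add: v'_def)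
  qed
qed

lemma finite_james_q_fiber:
  "finite {f \<in> topspace (power_top X n). james_q e n f = d}"
proof (rule finite_subset)
  show "finite ({..<n} \<rightarrow>\<^sub>E insert e (set d))" by (intro finite_PiE) auto
  show "{f \<in> topspace (power_top X n). james_q e n f = d} \<subseteq> ({..<n} \<rightarrow>\<^sub>E insert e (set d))"
  proof
    fix f assume f: "f \<in> {f \<in> topspace (power_top X n). james_q e n f = d}"
    have "f i \<in> insert e (set d)" if "i < n" for i
      using f that by (auto simp: james_q_def)
    moreover have "f \<in> extensional {..<n}" using f by (auto simp: topspace_power_top PiE_def)
    ultimately show "f \<in> ({..<n} \<rightarrow>\<^sub>E insert e (set d))" by (auto simp: PiE_def)
  qed
qed

lemma openin_james_Diff:
  assumes "Hausdorff_space X" "\<And>n. finite {d \<in> D. length d \<le> n}"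
  shows "openin (james X e) (james_words X e - D)"
  unfolding openin_james
proof (intro conjI allI)
  fix n
  have H: "Hausdorff_space (power_top X n)"
    unfolding power_top_def using assms(1) by (simp add: Hausdorff_space_product_topology)
  let ?B = "\<Union>d\<in>{d \<in> D. length d \<le> n}. {f \<in> topspace (power_top X n). james_q e n f = d}"
  have "finite ?B" by (intro finite_UN_I assms(2) finite_james_q_fiber)
  then have "closedin (power_top X n) ?B"
    by (intro closedin_Hausdorff_finite[OF H]) auto
  moreover have "{f \<in> topspace (power_top X n). james_q e n f \<in> james_words X e - D}
      = topspace (power_top X n) - ?B"
    using james_q_in_Jn_set[of _ X n e] by (auto simp: james_Jn_set_def)
  ultimately show "openin (power_top X n)
      {f \<in> topspace (power_top X n). james_q e n f \<in> james_words X e - D}"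
    by (simp only: openin_diff openin_topspace)
qed blast

text \<open>A set of words containing only finitely many words of each length is closed and discrete,
  so a compact set cannot contain words of unbounded length.\<close>

lemma compactin_james_bounded_length:
  assumes H: "Hausdorff_space X" and C: "compactin (james X e) C"
  obtains n where "\<And>v. v \<in> C \<Longrightarrow> length v \<le> n"
proof -
  have "\<exists>n. \<forall>v\<in>C. length v \<le> n"
  proof (rule ccontr)
    assume "\<not> ?thesis"
    then have "\<forall>k. \<exists>v. v \<in> C \<and> k < length v" by (meson not_less)
    then obtain v where v: "\<And>k. v k \<in> C" "\<And>k. k < length (v k)" by metis
    have fin: "finite {d \<in> D. length d \<le> n}" if D: "D \<subseteq> range v" for D n
    proof (rule finite_subset)
      show "{d \<in> D. length d \<le> n} \<subseteq> v ` {..<n}"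
        
    proof
      fix d assume d: "d \<in> {d \<in> D. length d \<le> n}"
      then obtain k where "d = v k" using D by blast
      with d v(2)[of k] show "d \<in> v ` {..<n}" by auto
    qed
    qed simp
    define O' where "O' d = james_words X e - (range v - {d})" for d
    have CW: "C \<subseteq> james_words X e" using compactin_subset_topspace[OF C] by (simp add: topspace_james)
    have "\<And>u. u \<in> O' ` range v \<Longrightarrow> openin (james X e) u"
      unfolding O'_def by (auto intro!: openin_james_Diff H fin)
    moreover have "C \<subseteq> \<Union>(O' ` range v)"
      using CW unfolding O'_def by auto
    ultimately obtain \<F> where \<F>: "finite \<F>" "\<F> \<subseteq> O' ` range v" "C \<subseteq> \<Union>\<F>"
      using C unfolding compactin_def by meson
    then obtain F where F: "finite F" "\<F> = O' ` F"
      by (meson finite_subset_image)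
    have "range v \<subseteq> F"
    proof
      fix d assume d: "d \<in> range v"
      then have "d \<in> C" using v by blast
      then have "d \<in> \<Union>(O' ` F)" using \<F>(3) F(2) by blast
      then obtain d' where "d' \<in> F" "d \<in> O' d'" by blast
      with d show "d \<in> F" unfolding O'_def by blast
    qed
    then have "finite (length ` range v)" using F finite_subset by blast
    then obtain N where "\<And>k. length (v k) \<le> N"
      unfolding finite_nat_set_iff_bounded_le by auto
    with v(2)[of N] show False by (meson not_less)
  qed
  with that show thesis by blast
qed

lemma continuous_map_james_fits:
  assumes e: "e \<in> topspace X"
    and f: "\<And>k. k \<in> topspace K \<Longrightarrow> set (f k) \<subseteq> topspace X \<and> length (f k) \<le> n"
    and loc: "\<And>k G. k \<in> topspace K \<Longrightarrow> (\<And>a. a \<in> insert e (set (f k)) \<Longrightarrow> openin X (G a) \<and> a \<in> G a)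
        \<Longrightarrow> \<exists>T. openin K T \<and> k \<in> T \<and> (\<forall>k'\<in>T. fits (G e) (map G (f k)) (f k'))"
  shows "continuous_map K (james X e) (\<lambda>k. filter (\<lambda>a. a \<noteq> e) (f k))"
  unfolding continuous_map_def topspace_james
proof (intro conjI allI impI)
  show "(\<lambda>k. filter (\<lambda>a. a \<noteq> e) (f k)) \<in> topspace K \<rightarrow> james_words X e"
    using f by (fastforce simp: james_words_def)
next
  fix W assume W: "openin (james X e) W"
  show "openin K {k \<in> topspace K. filter (\<lambda>a. a \<noteq> e) (f k) \<in> W}" (is "openin K ?S")
  proof (subst openin_subopen, intro ballI)
    fix k assume k: "k \<in> ?S"
    then obtain G where G: "\<And>a. a \<in> insert e (set (f k)) \<Longrightarrow> openin X (G a) \<and> a \<in> G a"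
      "\<And>v. length v \<le> n \<Longrightarrow> fits (G e) (map G (f k)) v \<Longrightarrow> filter (\<lambda>a. a \<noteq> e) v \<in> W"
      using james_nhd_fits[OF W e, of "f k" n] f by auto
    from k obtain T where T: "openin K T" "k \<in> T" "\<And>k'. k' \<in> T \<Longrightarrow> fits (G e) (map G (f k)) (f k')"
      using loc[of k G] G(1) by blast
    have "T \<subseteq> ?S" using T G(2) f openin_subset[OF T(1)] by blast
    with T show "\<exists>T. openin K T \<and> k \<in> T \<and> T \<subseteq> ?S" by blast
  qed
qed

lemma continuous_map_james_sigma:
  assumes "e \<in> topspace X"
  shows "continuous_map X (james X e) (james_sigma e)"
proof -
  have "continuous_map X (james X e) (\<lambda>x. filter (\<lambda>a. a \<noteq> e) [x])"
  proof (rule continuous_map_james_fits[OF assms, where n = 1])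
    fix x G assume "\<And>a. a \<in> insert e (set [x]) \<Longrightarrow> openin X (G a) \<and> a \<in> G a"
    then show "\<exists>T. openin X T \<and> x \<in> T \<and> (\<forall>k'\<in>T. fits (G e) (map G [x]) [k'])"
      by (intro exI[of _ "G x"]) (auto simp: fits.intros)
  qed auto
  moreover have "james_sigma e = (\<lambda>x. filter (\<lambda>a. a \<noteq> e) [x])"
    by (auto simp: james_sigma_def)
  ultimately show ?thesis by simp
qed

lemma continuous_map_james_length_le_1:
  assumes e: "e \<in> topspace X" and g: "continuous_map K (james X e) g"
    and len: "\<And>k. k \<in> topspace K \<Longrightarrow> length (g k) \<le> 1"
  obtains b where "continuous_map K X b" "\<forall>k\<in>topspace K. g k = james_sigma e (b k)"
proof
  let ?b = "\<lambda>k. case g k of [] \<Rightarrow> e | x # _ \<Rightarrow> x"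
  have words: "g k \<in> james_words X e" if "k \<in> topspace K" for k
    using g that by (auto simp: continuous_map_def topspace_james)
  have cases: "g k = [] \<or> (\<exists>x. g k = [x] \<and> x \<in> topspace X \<and> x \<noteq> e)" if "k \<in> topspace K" for k
    using len[OF that] words[OF that] by (cases "g k") (auto simp: james_words_def)
  show "\<forall>k\<in>topspace K. g k = james_sigma e (?b k)"
    using cases by (fastforce simp: james_sigma_def)
  show "continuous_map K X ?b"
    unfolding continuous_map_def
  proof (intro conjI allI impI)
    show "?b \<in> topspace K \<rightarrow> topspace X" using cases e by fastforce
  next
    fix A assume A: "openin X A"
    define W where "W = {v \<in> james_words X e. if e \<in> A then fits A [] v else fits (topspace X) [A] v}"
    have "openin (james X e) W"
      using A e by (cases "e \<in> A") (auto simp: W_def intro: openin_james_fits)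
    then have "openin K {k \<in> topspace K. g k \<in> W}" using g by (simp add: continuous_map_def)
    moreover have "?b k \<in> A \<longleftrightarrow> g k \<in> W" if "k \<in> topspace K" for k
      using cases[OF that] words[OF that]
      by (auto simp: W_def fits.simps[of _ _ "[_]"])
    then have "{k \<in> topspace K. ?b k \<in> A} = {k \<in> topspace K. g k \<in> W}" by blast
    ultimately show "openin K {k \<in> topspace K. ?b k \<in> A}" by simp
  qed
qed

lemma map_nth_filter: "map (nth v) (filter (\<lambda>j. P (v ! j)) [0..<length v]) = filter P v"
  using filter_map[of P "nth v" "[0..<length v]"] by (simp add: map_nth o_def)

section \<open>Lives of letters\<close>

text \<open>The loop is extended by the empty word to all of \<open>\<real>\<close>. The disjoint open sets \<open>U t\<close> and \<open>V t\<close>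
  tell, for words near \<open>w t\<close>, the letters that continue those of \<open>w t\<close> from the newborn ones.\<close>

locale james_path =
  fixes X :: "'a topology" and e :: 'a and w :: "real \<Rightarrow> 'a list" and n :: nat
    and U V :: "real \<Rightarrow> 'a set"
  assumes e: "e \<in> topspace X"
    and cont: "continuous_map euclideanreal (james X e) w"
    and length_le: "length (w t) \<le> n"
    and outside: "t \<notin> {0<..<1} \<Longrightarrow> w t = []"
    and U: "openin X (U t)" "e \<in> U t"
    and V: "openin X (V t)" "set (w t) \<subseteq> V t"
    and UV: "U t \<inter> V t = {}"
begin

lemma in_words: "w t \<in> james_words X e"
  using cont by (auto simp: continuous_map_def topspace_james)

lemma letters: "set (w t) \<subseteq> topspace X - {e}"
  using in_words by (auto simp: james_words_def)

lemma ev_fits: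
  assumes "openin X A" "e \<in> A" "\<And>B. B \<in> set Bs \<Longrightarrow> openin X B" "list_all2 (\<in>) (w t) Bs"
  shows "\<forall>\<^sub>F s in nhds t. fits A Bs (w s)"
proof -
  have eV: "e \<notin> V t" using U UV by blast
  have "openin (james X e) {v \<in> james_words X e. fits A (map (\<lambda>B. B \<inter> V t) Bs) v}"
    using assms eV V by (intro openin_james_fits) auto
  then have "open {s. w s \<in> {v \<in> james_words X e. fits A (map (\<lambda>B. B \<inter> V t) Bs) v}}"
    using cont by (auto simp: continuous_map_def)
  moreover have "fits A (map (\<lambda>B. B \<inter> V t) Bs) (map id (w t))"
    using assms(4) V(2)
    by (intro fits_map_filterI[where P = "\<lambda>_. True"])
       (auto simp: list_all2_conv_all_nth subset_iff)
  ultimately have "\<forall>\<^sub>F s in nhds t. fits A (map (\<lambda>B. B \<inter> V t) Bs) (w s)"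
    using in_words by (auto simp: eventually_nhds)
  then show ?thesis
  proof eventually_elim
    case (elim s)
    then show ?case using fits_map[OF elim, of id A id] by simp
  qed
qed

text \<open>The positions in \<open>w s\<close> of the continuations of the letters of \<open>w t\<close>, for \<open>s\<close> near \<open>t\<close>.\<close>

definition far :: "real \<Rightarrow> real \<Rightarrow> nat list" where
  "far t s = filter (\<lambda>j. w s ! j \<notin> U t) [0..<length (w s)]"

lemma distinct_far [simp]: "distinct (far t s)"
  by (simp add: far_def)

lemma set_far: "j \<in> set (far t s) \<longleftrightarrow> j < length (w s) \<and> w s ! j \<notin> U t"
  by (auto simp: far_def)

lemma far_self: "far t t = [0..<length (w t)]"
  unfolding far_def using V(2)[of t] UV[of t] by (auto simp: filter_id_conv subset_iff disjoint_iff)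

definition near :: "real \<Rightarrow> real \<Rightarrow> bool" where
  "near t s \<longleftrightarrow> length (far t s) = length (w t) \<and> set (w s) \<subseteq> U t \<union> V t"

lemma far_less: "near t s \<Longrightarrow> i < length (w t) \<Longrightarrow> far t s ! i < length (w s)"
  by (metis near_def nth_mem set_far)

lemma ev_far:
  assumes "openin X A" "e \<in> A" "\<And>j. j < length (w t) \<Longrightarrow> openin X (B j) \<and> w t ! j \<in> B j"
  shows "\<forall>\<^sub>F s in nhds t. near t s \<and> (\<forall>j<length (w t). w s ! (far t s ! j) \<in> B j)
     \<and> (\<forall>j<length (w s). j \<notin> set (far t s) \<longrightarrow> w s ! j \<in> A)"
proof -
  let ?Bs = "map (\<lambda>j. B j \<inter> V t) [0..<length (w t)]"
  have "\<forall>\<^sub>F s in nhds t. fits (A \<inter> U t) ?Bs (w s)"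
  proof (rule ev_fits)
    show "list_all2 (\<in>) (w t) ?Bs"
      using V(2)[of t] assms by (auto simp: list_all2_conv_all_nth subset_iff)
  qed (use assms U V in auto)
  then show ?thesis
  proof eventually_elim
    case (elim s)
    have lt: "a \<in> A \<inter> U t \<or> a \<in> V t" if "a \<in> set (w s)" for a
      using fits_letter[OF elim that] by auto
    have "list_all2 (\<in>) (filter (\<lambda>x. x \<notin> A \<inter> U t) (w s)) ?Bs"
      by (rule fits_list_all2_filter[OF elim]) (use UV[of t] in auto)
    also have "filter (\<lambda>x. x \<notin> A \<inter> U t) (w s) = filter (\<lambda>x. x \<notin> U t) (w s)"
      using lt UV[of t] by (intro filter_cong) auto
    also have "\<dots> = map (nth (w s)) (far t s)"
      unfolding far_def by (rule map_nth_filter[symmetric])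
    finally have all: "list_all2 (\<in>) (map (nth (w s)) (far t s)) ?Bs" .
    then have "length (far t s) = length (w t)" by (auto dest: list_all2_lengthD)
    moreover have "w s ! (far t s ! j) \<in> B j" if "j < length (w t)" for j
      using all that by (auto simp: list_all2_conv_all_nth)
    moreover have "w s ! j \<in> A" if "j < length (w s)" "j \<notin> set (far t s)" for j
      using lt[of "w s ! j"] that UV[of t] by (auto simp: set_far)
    ultimately show ?case using lt by (auto simp: near_def)
  qed
qed

lemma ev_near: "\<forall>\<^sub>F s in nhds t. near t s"
  using ev_far[of "topspace X" t "\<lambda>_. topspace X"] e letters[of t]
  by (auto elim: eventually_mono simp: subset_iff)

lemma ev_far_compose:
  assumes "near t s"
  shows "\<forall>\<^sub>F u in nhds s. near s u \<and> far t u = map (nth (far s u)) (far t s)"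
proof -
  define B where "B j = (if w s ! j \<in> U t then U t else V t)" for j
  have "w s ! j \<in> B j" if "j < length (w s)" for j
  proof -
    have "w s ! j \<in> U t \<union> V t" using assms nth_mem[OF that] unfolding near_def by blast
    then show ?thesis by (auto simp: B_def)
  qed
  then have "\<forall>\<^sub>F u in nhds s. near s u \<and> (\<forall>j<length (w s). w u ! (far s u ! j) \<in> B j)
     \<and> (\<forall>j<length (w u). j \<notin> set (far s u) \<longrightarrow> w u ! j \<in> U t)"
    using U V by (intro ev_far) (auto simp: B_def)
  then show ?thesis
  proof eventually_elim
    case (elim u)
    let ?F = "far s u"
    have lF: "length ?F = length (w s)" using elim by (simp add: near_def)
    have iff: "w u ! (?F ! j) \<notin> U t \<longleftrightarrow> w s ! j \<notin> U t" if "j < length (w s)" for j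
      using elim that UV[of t] by (fastforce simp: B_def split: if_splits)
    have "far t u = filter (\<lambda>j. w u ! j \<notin> U t \<and> w u ! j \<notin> U s) [0..<length (w u)]"
      unfolding far_def using elim by (intro filter_cong) (auto simp: set_far)
    also have "\<dots> = filter (\<lambda>j. w u ! j \<notin> U t) ?F"
      by (simp add: far_def conj_commute)
    also have "\<dots> = filter (\<lambda>j. w u ! j \<notin> U t) (map (nth ?F) [0..<length (w s)])"
      by (metis lF map_nth)
    also have "\<dots> = map (nth ?F) (filter (\<lambda>j. w u ! (?F ! j) \<notin> U t) [0..<length (w s)])"
      by (simp add: filter_map o_def)
    also have "filter (\<lambda>j. w u ! (?F ! j) \<notin> U t) [0..<length (w s)] = far t s"
      unfolding far_def[of t s] using iff by (intro filter_cong) auto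
    finally show ?case using elim by blast
  qed
qed

definition track :: "(real \<Rightarrow> nat) \<Rightarrow> real \<Rightarrow> bool" where
  "track p t \<longleftrightarrow> p t < length (w t) \<and> (\<forall>\<^sub>F s in nhds t. p s = far t s ! p t)"

definition conn :: "real \<times> nat \<Rightarrow> real \<times> nat \<Rightarrow> bool" where
  "conn x y \<longleftrightarrow> (\<exists>S p. open S \<and> connected S \<and> fst x \<in> S \<and> fst y \<in> S \<and>
     p (fst x) = snd x \<and> p (fst y) = snd y \<and> (\<forall>t\<in>S. track p t))"

lemma tracks_agree:
  assumes S: "open S" "connected S" and p: "\<And>t. t \<in> S \<Longrightarrow> track p t" and q: "\<And>t. t \<in> S \<Longrightarrow> track q t"
    and t: "t \<in> S" "p t = q t" and s: "s \<in> S"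
  shows "p s = q s"
proof -
  have "\<forall>\<^sub>F u in nhds s. (p s = q s) = (p u = q u)" if "s \<in> S" for s
  proof -
    have "\<forall>\<^sub>F u in nhds s. p u = far s u ! p s" "\<forall>\<^sub>F u in nhds s. q u = far s u ! q s"
      using p q that by (auto simp: track_def)
    with ev_near[of s] show ?thesis
    proof eventually_elim
      case (elim u)
      then show ?case using p[OF that] q[OF that]
        by (auto simp: near_def track_def nth_eq_iff_index_eq)
    qed
  qed
  then have "\<forall>s\<in>S. \<forall>\<^sub>F u in at s within S. (p s = q s) = (p u = q u)"
    unfolding eventually_at_filter by (blast intro: eventually_mono)
  from connected_local_const[OF S(2) t(1) s this] t(2) show ?thesis by simp
qed

lemma conn_sym: "conn x y \<Longrightarrow> conn y x"
  unfolding conn_def by blast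

lemma conn_same_time: "conn (t, i) (t, j) \<Longrightarrow> i = j"
  unfolding conn_def by auto

lemma track_cong:
  assumes "track p t" "open S" "t \<in> S" "\<And>s. s \<in> S \<Longrightarrow> p s = q s"
  shows "track q t"
proof -
  have "\<forall>\<^sub>F s in nhds t. s \<in> S" using assms eventually_nhds_in_open by blast
  moreover have "\<forall>\<^sub>F s in nhds t. p s = far t s ! p t" using assms by (simp add: track_def)
  ultimately have "\<forall>\<^sub>F s in nhds t. q s = far t s ! q t"
    by eventually_elim (use assms in auto)
  then show ?thesis using assms by (auto simp: track_def)
qed

lemma conn_trans:
  assumes "conn x y" "conn y z"
  shows "conn x z"
proof -
  obtain S p where S: "open S" "connected S" "fst x \<in> S" "fst y \<in> S"
     "p (fst x) = snd x" "p (fst y) = snd y" "\<And>t. t \<in> S \<Longrightarrow> track p t"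
    using assms(1) unfolding conn_def by blast
  obtain T q where T: "open T" "connected T" "fst y \<in> T" "fst z \<in> T"
     "q (fst y) = snd y" "q (fst z) = snd z" "\<And>t. t \<in> T \<Longrightarrow> track q t"
    using assms(2) unfolding conn_def by blast
  have ST: "connected (S \<inter> T)"
    using S(2) T(2) by (simp add: is_interval_connected_1[symmetric] is_interval_Int)
  have agree: "p s = q s" if "s \<in> S \<inter> T" for s
    using tracks_agree[OF open_Int[OF S(1) T(1)] ST _ _ _ _ that, of p q "fst y"] S T by auto
  define r where "r t = (if t \<in> S then p t else q t)" for t
  have rT: "r t = q t" if "t \<in> T" for t using agree that by (auto simp: r_def)
  have rS: "r t = p t" if "t \<in> S" for t using that by (auto simp: r_def)
  have "track r t" if "t \<in> S \<union> T" for t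
    using that
  proof
    assume t: "t \<in> S"
    show ?thesis by (rule track_cong[OF S(7)[OF t] S(1) t]) (simp add: rS)
  next
    assume t: "t \<in> T"
    show ?thesis by (rule track_cong[OF T(7)[OF t] T(1) t]) (simp add: rT)
  qed
  moreover have "connected (S \<union> T)" using S T by (intro connected_Un) auto
  moreover have "open (S \<union> T)" using S T by auto
  moreover have "r (fst x) = snd x" "r (fst z) = snd z" using rS rT S T by auto
  ultimately show ?thesis unfolding conn_def using S T by blast
qed

lemma ev_conn: "\<forall>\<^sub>F s in nhds t. near t s \<and> (\<forall>i<length (w t). conn (t, i) (s, far t s ! i))"
proof -
  obtain d where d: "d > 0" "\<And>s. s \<in> ball t d \<Longrightarrow> near t s"
    using ev_near[of t] unfolding eventually_nhds_metric by (auto simp: dist_commute)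
  have tr: "track (\<lambda>s. far t s ! i) s" if s: "s \<in> ball t d" and i: "i < length (w t)" for s i
    unfolding track_def
  proof
    have near: "near t s" using d s by blast
    then show "far t s ! i < length (w s)" using i by (rule far_less)
    show "\<forall>\<^sub>F u in nhds s. far t u ! i = far s u ! (far t s ! i)"
      using ev_far_compose[OF near]
      by eventually_elim (use near i in \<open>auto simp: near_def\<close>)
  qed
  have "conn (t, i) (s, far t s ! i)" if s: "s \<in> ball t d" and i: "i < length (w t)" for s i
    unfolding conn_def
    by (rule exI[of _ "ball t d"], rule exI[of _ "\<lambda>s. far t s ! i"])
       (use s i d(1) tr in \<open>auto simp: far_self\<close>)
  moreover have "\<forall>\<^sub>F s in nhds t. s \<in> ball t d"
    using d(1) by (intro eventually_nhds_in_open) auto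
  ultimately show ?thesis using d(2) by (auto elim: eventually_mono)
qed

lemma conn_refl: "i < length (w t) \<Longrightarrow> conn (t, i) (t, i)"
  using eventually_nhds_x_imp_x[OF ev_conn[of t]] by (auto simp: far_self)

text \<open>A life is represented by the set of all pairs (time, position) of its letter.\<close>

definition lab :: "real \<Rightarrow> nat \<Rightarrow> (real \<times> nat) set" where
  "lab t i = {y. conn (t, i) y}"

lemma lab_eq_iff:
  assumes "i < length (w t)"
  shows "lab t i = lab s j \<longleftrightarrow> conn (t, i) (s, j)"
  unfolding lab_def using conn_refl[OF assms] conn_sym conn_trans by blast

definition labs :: "real \<Rightarrow> (real \<times> nat) set list" where
  "labs t = map (lab t) [0..<length (w t)]"

lemma length_labs [simp]: "length (labs t) = length (w t)"
  by (simp add: labs_def)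

lemma nth_labs: "i < length (w t) \<Longrightarrow> labs t ! i = lab t i"
  by (simp add: labs_def)

lemma distinct_labs: "distinct (labs t)"
  by (auto simp: labs_def distinct_map inj_on_def lab_eq_iff dest: conn_same_time)

lemma labs_outside: "t \<notin> {0<..<1} \<Longrightarrow> labs t = []"
  using outside[of t] by (simp add: labs_def)

lemma labs_convex:
  assumes m: "m \<in> set (labs r)" "m \<in> set (labs t)" and s: "r \<le> s" "s \<le> t"
  shows "m \<in> set (labs s)"
proof -
  obtain i j where i: "i < length (w r)" "m = lab r i" and j: "j < length (w t)" "m = lab t j"
    using m by (auto simp: labs_def)
  then have "conn (r, i) (t, j)" using lab_eq_iff[OF i(1), of t j] by simp
  then obtain S p where S: "open S" "connected S" "r \<in> S" "t \<in> S"
     "p r = i" "p t = j" "\<forall>t\<in>S. track p t"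
    unfolding conn_def by auto
  have sS: "s \<in> S" using S s by (meson connectedD_interval)
  then have "conn (r, i) (s, p s)" unfolding conn_def using S by auto
  moreover have "p s < length (w s)" using S sS by (auto simp: track_def)
  ultimately show ?thesis using i lab_eq_iff by (auto simp: labs_def)
qed

lemma ev_labs: "\<forall>\<^sub>F s in nhds t. near t s \<and> (\<forall>i<length (w t). labs s ! (far t s ! i) = labs t ! i)"
  using ev_conn[of t]
proof eventually_elim
  case (elim s)
  then have "lab t i = lab s (far t s ! i)" if "i < length (w t)" for i
    using that by (simp add: lab_eq_iff)
  with elim show ?case by (simp add: nth_labs far_less)
qed

lemma labs_far_iff:
  assumes "near t s" "\<forall>i<length (w t). labs s ! (far t s ! i) = labs t ! i" "j < length (w s)"
  shows "labs s ! j \<in> set (labs t) \<longleftrightarrow> j \<in> set (far t s)"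
proof
  assume "labs s ! j \<in> set (labs t)"
  then obtain i where i: "i < length (w t)" "labs s ! j = labs t ! i" by (auto simp: in_set_conv_nth)
  then have "labs s ! j = labs s ! (far t s ! i)" using assms by simp
  then have "j = far t s ! i"
    using assms i far_less[OF assms(1) i(1)] nth_eq_iff_index_eq[OF distinct_labs, of j s "far t s ! i"]
    by simp
  then show "j \<in> set (far t s)" using i assms(1) by (simp add: near_def)
next
  assume "j \<in> set (far t s)"
  then show "labs s ! j \<in> set (labs t)"
    using assms by (fastforce simp: in_set_conv_nth near_def)
qed

lemma ev_labs_fits:
  "\<forall>\<^sub>F s in nhds t. fits (- set (labs t)) (map (\<lambda>m. {m}) (labs t)) (labs s)"
  using ev_labs[of t]
proof eventually_elim
  case (elim s)
  have "fits (- set (labs t)) (map (\<lambda>m. {m}) (labs t)) (map (nth (labs s)) [0..<length (w s)])"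
  proof (rule fits_map_filterI[where P = "\<lambda>j. w s ! j \<notin> U t"])
    show "list_all2 (\<in>) (map (nth (labs s)) (filter (\<lambda>j. w s ! j \<notin> U t) [0..<length (w s)]))
        (map (\<lambda>m. {m}) (labs t))"
      using elim unfolding far_def[symmetric] by (auto simp: list_all2_conv_all_nth near_def)
  next
    fix j assume j: "j \<in> set [0..<length (w s)]" "\<not> w s ! j \<notin> U t"
    then have "j \<notin> set (far t s)" by (simp add: set_far)
    with j elim show "labs s ! j \<in> - set (labs t)"
      using labs_far_iff[of t s j] by simp
  qed
  also have "map (nth (labs s)) [0..<length (w s)] = labs s"
    using map_nth[of "labs s"] by simp
  finally show ?case .
qed

definition letter :: "(real \<times> nat) set \<Rightarrow> real \<Rightarrow> 'a" where
  "letter m t = (if m \<in> set (labs t) then w t ! (THE i. i < length (w t) \<and> labs t ! i = m) else e)"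

lemma letter_labs: "i < length (w t) \<Longrightarrow> letter (labs t ! i) t = w t ! i"
proof -
  assume i: "i < length (w t)"
  then have "(THE j. j < length (w t) \<and> labs t ! j = labs t ! i) = i"
    using distinct_labs[of t] by (intro the_equality) (auto simp: nth_eq_iff_index_eq)
  with i show ?thesis by (simp add: letter_def)
qed

lemma letter_not_alive: "m \<notin> set (labs t) \<Longrightarrow> letter m t = e"
  by (simp add: letter_def)

lemma map_letter_labs: "map (\<lambda>m. letter m t) (labs t) = w t"
  by (rule nth_equalityI) (auto simp: letter_labs)

lemma ev_letter_other:
  assumes "openin X A" "e \<in> A"
  shows "\<forall>\<^sub>F s in nhds t. \<forall>m. m \<notin> set (labs t) \<longrightarrow> letter m s \<in> A"
proof -
  have "\<forall>\<^sub>F s in nhds t. near t s \<and> (\<forall>j<length (w t). w s ! (far t s ! j) \<in> topspace X)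
     \<and> (\<forall>j<length (w s). j \<notin> set (far t s) \<longrightarrow> w s ! j \<in> A)"
    using assms letters[of t] by (intro ev_far) (auto simp: subset_iff)
  with ev_labs[of t] show ?thesis
  proof eventually_elim
    case (elim s)
    show ?case
    proof (intro allI impI)
      fix m assume m: "m \<notin> set (labs t)"
      show "letter m s \<in> A"
      proof (cases "m \<in> set (labs s)")
        case True
        then obtain j where j: "j < length (w s)" "m = labs s ! j" by (auto simp: in_set_conv_nth)
        then show ?thesis using elim m labs_far_iff[of t s j] by (auto simp: letter_labs)
      next
        case False
        then show ?thesis using assms by (simp add: letter_not_alive)
      qed
    qed
  qed
qed

lemma ev_letter_alive:
  assumes "i < length (w t)" "openin X A" "w t ! i \<in> A"
  shows "\<forall>\<^sub>F s in nhds t. letter (labs t ! i) s \<in> A"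
proof -
  have "\<forall>\<^sub>F s in nhds t. near t s \<and> (\<forall>j<length (w t). w s ! (far t s ! j) \<in> (if j = i then A else topspace X))
     \<and> (\<forall>j<length (w s). j \<notin> set (far t s) \<longrightarrow> w s ! j \<in> topspace X)"
    using assms letters[of t] e by (intro ev_far) (auto simp: subset_iff)
  with ev_labs[of t] show ?thesis
  proof eventually_elim
    case (elim s)
    then have "labs t ! i = labs s ! (far t s ! i)" "far t s ! i < length (w s)" "w s ! (far t s ! i) \<in> A"
      using assms far_less by auto
    then show ?case by (simp add: letter_labs)
  qed
qed

lemma letter_in_topspace: "letter m t \<in> topspace X"
proof (cases "m \<in> set (labs t)")
  case True
  then obtain j where "j < length (w t)" "m = labs t ! j" by (auto simp: in_set_conv_nth)
  moreover have "w t ! j \<in> topspace X" if "j < length (w t)" for j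
    using letters[of t] nth_mem[OF that] by blast
  ultimately show ?thesis by (simp add: letter_labs)
next
  case False
  then show ?thesis using e by (simp add: letter_not_alive)
qed

lemma continuous_letter: "continuous_map euclideanreal X (letter m)"
  unfolding continuous_map_def
proof (intro conjI allI impI)
  show "letter m \<in> topspace euclideanreal \<rightarrow> topspace X" using letter_in_topspace by simp
next
  fix A assume A: "openin X A"
  have "\<forall>\<^sub>F s in nhds t. letter m s \<in> A" if t: "letter m t \<in> A" for t
  proof (cases "m \<in> set (labs t)")
    case True
    then obtain i where i: "i < length (w t)" "m = labs t ! i" by (auto simp: in_set_conv_nth)
    then show ?thesis using ev_letter_alive[OF i(1) A] t by (simp add: letter_labs)
  next
    case False
    then have "\<forall>\<^sub>F s in nhds t. \<forall>m. m \<notin> set (labs t) \<longrightarrow> letter m s \<in> A"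
      using ev_letter_other[OF A] t by (simp add: letter_not_alive)
    then show ?thesis by eventually_elim (use False in blast)
  qed
  then show "openin euclideanreal {t \<in> topspace euclideanreal. letter m t \<in> A}"
    unfolding eventually_nhds
    by (subst openin_subopen) (simp add: subset_iff, blast)
qed

lemma finite_large_letters:
  assumes A: "openin X A" "e \<in> A"
  shows "finite {m. \<exists>t. letter m t \<notin> A}"
proof -
  have "\<forall>t. \<exists>T. open T \<and> t \<in> T \<and> (\<forall>s\<in>T. \<forall>m. m \<notin> set (labs t) \<longrightarrow> letter m s \<in> A)"
    using ev_letter_other[OF A] unfolding eventually_nhds by blast
  then obtain T where T: "\<And>t. open (T t)" "\<And>t. t \<in> T t"
    "\<And>t s m. s \<in> T t \<Longrightarrow> m \<notin> set (labs t) \<Longrightarrow> letter m s \<in> A" by metis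
  have "compact {0..1::real}" by simp
  then obtain F where F: "finite F" "{0..1} \<subseteq> (\<Union>t\<in>F. T t)"
    by (rule compactE_image[of _ "{0..1}" T]) (use T in auto)
  have "{m. \<exists>t. letter m t \<notin> A} \<subseteq> (\<Union>t\<in>F. set (labs t))"
  proof
    fix m assume "m \<in> {m. \<exists>t. letter m t \<notin> A}"
    then obtain t where t: "letter m t \<notin> A" by blast
    then have "letter m t \<noteq> e" using A by auto
    then have "t \<in> {0..1}" using letter_not_alive[of m t] labs_outside[of t] by fastforce
    then obtain u where "u \<in> F" "t \<in> T u" using F by blast
    then show "m \<in> (\<Union>t\<in>F. set (labs t))" using T(3) t by blast
  qed
  then show ?thesis using F finite_subset by blast
qed

section \<open>Separating the lives by a homotopy\<close>

lemma labs_eventually_constant: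
  assumes "m \<in> set (labs t)"
  obtains u where "m \<in> set (labs u)" "\<forall>\<^sub>F s in nhds u. labs s = labs u"
proof -
  have "\<forall>s. m \<in> set (labs s) \<longrightarrow> length (w s) < Suc n"
    using length_le by (simp add: less_Suc_eq_le)
  then obtain u where u: "m \<in> set (labs u)" "\<And>s. m \<in> set (labs s) \<Longrightarrow> length (w s) \<le> length (w u)"
    using ex_has_greatest_nat[of "\<lambda>s. m \<in> set (labs s)" t "\<lambda>s. length (w s)" "Suc n"] assms by blast
  obtain i where i: "i < length (w u)" "m = labs u ! i" using u(1) by (auto simp: in_set_conv_nth)
  have "\<forall>\<^sub>F s in nhds u. labs s = labs u"
    using ev_labs[of u]
  proof eventually_elim
    case (elim s)
    have lab: "labs s ! (far u s ! j) = labs u ! j" "far u s ! j < length (w s)" if "j < length (w u)" for j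
      using elim that far_less by auto
    have "m \<in> set (labs s)" using lab[OF i(1)] i(2) by (metis length_labs nth_mem)
    then have "length (w s) \<le> length (far u s)" using u(2) elim by (simp add: near_def)
    then have far: "far u s = [0..<length (w s)]"
      unfolding far_def
      by (metis (no_types, lifting) diff_zero filter_id_conv le_antisym length_filter_le
          length_filter_less length_upt linorder_not_less)
    moreover have "length (w u) = length (w s)" using elim far by (simp add: near_def)
    ultimately show ?case using lab by (auto intro!: nth_equalityI)
  qed
  with u that show thesis by blast
qed

text \<open>The interval of a life is a slot of an interval on which \<open>labs\<close> is constant; since the latter is
  chosen as a function of that constant alone, lives competing for it have distinct indices in it.\<close>

lemma disjoint_intervals:
  obtains a b :: "(real \<times> nat) set \<Rightarrow> real"
  where "\<And>m t. m \<in> set (labs t) \<Longrightarrow> a m < b m"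
    and "\<And>m t s. m \<in> set (labs t) \<Longrightarrow> s \<in> {a m<..<b m} \<Longrightarrow> m \<in> set (labs s)"
    and "\<And>m t m' t' s. m \<in> set (labs t) \<Longrightarrow> m' \<in> set (labs t') \<Longrightarrow>
      s \<in> {a m<..<b m} \<Longrightarrow> s \<in> {a m'<..<b m'} \<Longrightarrow> m = m'"
proof -
  have "\<forall>l. \<exists>p q. (\<exists>u. \<forall>\<^sub>F s in nhds u. labs s = l) \<longrightarrow> p < q \<and> (\<forall>s\<in>{p<..<q}. labs s = l)"
  proof
    fix l
    show "\<exists>p q. (\<exists>u. \<forall>\<^sub>F s in nhds u. labs s = l) \<longrightarrow> p < q \<and> (\<forall>s\<in>{p<..<q}. labs s = l)"
    proof (cases "\<exists>u. \<forall>\<^sub>F s in nhds u. labs s = l")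
      case True
      then obtain u d where "d > 0" "\<And>s. dist s u < d \<Longrightarrow> labs s = l"
        unfolding eventually_nhds_metric by blast
      then show ?thesis by (intro exI[of _ "u - d"] exI[of _ "u + d"]) (auto simp: dist_real_def)
    qed auto
  qed
  then obtain p q where pq: "\<And>l u. \<forall>\<^sub>F s in nhds u. labs s = l \<Longrightarrow> p l < q l"
    "\<And>l u s. \<forall>\<^sub>F s in nhds u. labs s = l \<Longrightarrow> p l < s \<Longrightarrow> s < q l \<Longrightarrow> labs s = l"
    unfolding choice_iff by (metis greaterThanLessThan_iff)
  have "\<forall>m. \<exists>u. (\<exists>t. m \<in> set (labs t)) \<longrightarrow> m \<in> set (labs u) \<and> (\<forall>\<^sub>F s in nhds u. labs s = labs u)"
    using labs_eventually_constant by metis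
  then obtain u where u: "\<And>m t. m \<in> set (labs t) \<Longrightarrow> m \<in> set (labs (u m))"
    "\<And>m t. m \<in> set (labs t) \<Longrightarrow> \<forall>\<^sub>F s in nhds (u m). labs s = labs (u m)" by metis
  have "\<forall>m. \<exists>i. (\<exists>t. m \<in> set (labs t)) \<longrightarrow> i < length (labs (u m)) \<and> labs (u m) ! i = m"
    using u(1) by (metis in_set_conv_nth)
  then obtain i where i: "\<And>m t. m \<in> set (labs t) \<Longrightarrow> i m < length (labs (u m))"
    "\<And>m t. m \<in> set (labs t) \<Longrightarrow> labs (u m) ! i m = m" by metis
  define h where "h l = (q l - p l) / length l" for l :: "(real \<times> nat) set list"
  define a where "a m = p (labs (u m)) + i m * h (labs (u m))" for m
  define b where "b m = p (labs (u m)) + (i m + 1) * h (labs (u m))" for m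
  have h: "h (labs (u m)) > 0" "length (labs (u m)) * h (labs (u m)) = q (labs (u m)) - p (labs (u m))"
    if "m \<in> set (labs t)" for m t
  proof -
    have "length (labs (u m)) > 0" using i(1)[OF that] by linarith
    then show "h (labs (u m)) > 0" "length (labs (u m)) * h (labs (u m)) = q (labs (u m)) - p (labs (u m))"
      using pq(1)[OF u(2)[OF that]] by (auto simp: h_def)
  qed
  have sub: "labs s = labs (u m)" if m: "m \<in> set (labs t)" and s: "s \<in> {a m<..<b m}" for m t s
  proof (rule pq(2)[OF u(2)[OF m]])
    have "real (i m) + 1 \<le> length (labs (u m))" using i(1)[OF m] by linarith
    then have "(real (i m) + 1) * h (labs (u m)) \<le> length (labs (u m)) * h (labs (u m))"
      using h(1)[OF m] by (intro mult_right_mono) auto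
    then show "s < q (labs (u m))" using s h(2)[OF m] by (auto simp: b_def add.commute)
    have "0 \<le> i m * h (labs (u m))" using h(1)[OF m] by simp
    then show "p (labs (u m)) < s" using s by (auto simp: a_def)
  qed
  show thesis
  proof (rule that)
    fix m t assume m: "m \<in> set (labs t)"
    show "a m < b m" using h(1)[OF m] by (simp add: a_def b_def algebra_simps)
    show "m \<in> set (labs s)" if "s \<in> {a m<..<b m}" for s
      using sub[OF m that] u(1)[OF m] by simp
  next
    fix m t m' t' s
    assume m: "m \<in> set (labs t)" and m': "m' \<in> set (labs t')"
      and s: "s \<in> {a m<..<b m}" and s': "s \<in> {a m'<..<b m'}"
    have eq: "labs (u m) = labs (u m')" using sub[OF m s] sub[OF m' s'] by simp
    let ?h = "h (labs (u m))"
    have "real (i m) * ?h < (real (i m') + 1) * ?h" "real (i m') * ?h < (real (i m) + 1) * ?h"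
      using s s' eq by (auto simp: a_def b_def add.commute)
    then have "real (i m) < real (i m') + 1" "real (i m') < real (i m) + 1"
      using h(1)[OF m] by (auto dest: mult_right_less_imp_less)
    then have "i m = i m'" by linarith
    then show "m = m'" using i(2)[OF m] i(2)[OF m'] eq by metis
  qed
qed

lemma homotopic_to_length_le_1:
  obtains h :: "real \<times> real \<Rightarrow> 'a list"
  where "continuous_map (prod_topology (top_of_set {0..1}) (top_of_set {0..1})) (james X e) h"
    and "\<forall>t. h (0, t) = w t"
    and "\<forall>t. length (h (1, t)) \<le> 1"
    and "\<forall>r t. t \<notin> {0<..<1} \<longrightarrow> h (r, t) = []"
proof -
  obtain a b :: "(real \<times> nat) set \<Rightarrow> real"
    where ab: "\<And>m t. m \<in> set (labs t) \<Longrightarrow> a m < b m"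
    and alive: "\<And>m t s. m \<in> set (labs t) \<Longrightarrow> s \<in> {a m<..<b m} \<Longrightarrow> m \<in> set (labs s)"
    and disj: "\<And>m t m' t' s. m \<in> set (labs t) \<Longrightarrow> m' \<in> set (labs t') \<Longrightarrow>
      s \<in> {a m<..<b m} \<Longrightarrow> s \<in> {a m'<..<b m'} \<Longrightarrow> m = m'"
    using disjoint_intervals by blast
  \<comment> \<open>the retimed clock of \<open>m\<close>, running from 0 to 1 during \<open>(a m, b m)\<close>\<close>
  define c where "c m t = max 0 (min 1 ((t - a m) / (b m - a m)))" for m t
  define g where "g m k = letter m ((1 - fst k) * snd k + fst k * c m (snd k))" for m and k :: "real \<times> real"
  define f where "f k = map (\<lambda>m. g m k) (labs (snd k))" for k
  have c0: "c m t = 0" if "m \<in> set (labs s)" "t \<le> a m" for m s t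
    using ab[OF that(1)] that(2) by (simp add: c_def divide_nonpos_pos)
  have c1: "c m t = 1" if "m \<in> set (labs s)" "t \<ge> b m" for m s t
    using ab[OF that(1)] that(2) by (simp add: c_def)
  have g_open: "\<forall>\<^sub>F k in nhds k0. g m k \<in> A" if A: "openin X A" "g m k0 \<in> A" for m k0 A
  proof -
    have "open {t. letter m t \<in> A}" using continuous_letter[of m] A by (simp add: continuous_map_def)
    moreover have "continuous_on UNIV (\<lambda>k. (1 - fst k) * snd k + fst k * c m (snd k))"
      unfolding c_def divide_inverse by (intro continuous_intros)
    ultimately have "open ((\<lambda>k. (1 - fst k) * snd k + fst k * c m (snd k)) -` {t. letter m t \<in> A})"
      by (rule open_vimage)
    from eventually_nhds_in_open[OF this, of k0] show ?thesis using A(2) by (simp add: g_def)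
  qed
  have g_e: "g m (r, t) = e" if m: "m \<in> set (labs s)" "m \<notin> set (labs t)"
    and rt: "r \<in> {0..1}" "t \<in> {0..1}" for m r s t
  proof -
    let ?x = "(1 - r) * t + r * c m t" and ?y = "(a m + b m) / 2"
    have y: "a m < ?y" "?y < b m" using ab[OF m(1)] by auto
    then have ay: "m \<in> set (labs ?y)" using alive[OF m(1)] by simp
    have "m \<notin> set (labs ?x)"
    proof
      assume ax: "m \<in> set (labs ?x)"
      have "t \<notin> {a m<..<b m}" using alive[OF m(1)] m(2) by blast
      then consider "t \<le> a m" | "t \<ge> b m" by fastforce
      then show False
      proof cases
        case 1
        then have "?x \<le> t" "t \<le> ?y"
          using c0[OF m(1) 1] y rt by (auto simp: mult_left_le_one_le)
        then show False using labs_convex[OF ax ay] m(2) by blast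
      next
        case 2
        have "r * t \<le> r" using rt by (auto simp: mult_left_le)
        then have "?y \<le> t" "t \<le> ?x" using c1[OF m(1) 2] 2 y by (auto simp: algebra_simps)
        then show False using labs_convex[OF ay ax] m(2) by blast
      qed
    qed
    then show ?thesis by (simp add: g_def letter_not_alive)
  qed
  show thesis
  proof (intro that allI impI)
    show "continuous_map (prod_topology (top_of_set {0..1}) (top_of_set {0..1})) (james X e)
        (\<lambda>k. filter (\<lambda>x. x \<noteq> e) (f k))"
    proof (rule continuous_map_james_fits[OF e, where n = n])
      fix k
      show "set (f k) \<subseteq> topspace X \<and> length (f k) \<le> n"
        using length_le letter_in_topspace by (auto simp: f_def g_def)
    next
      fix k :: "real \<times> real" and G
      assume "k \<in> topspace (prod_topology (top_of_set {0..1}) (top_of_set {0..1}))"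
        and G: "\<And>x. x \<in> insert e (set (f k)) \<Longrightarrow> openin X (G x) \<and> x \<in> G x"
      then have k: "k \<in> {0..1} \<times> {0..1}" by simp
      define F where "F = {m. \<exists>t. letter m t \<notin> G e}"
      have "finite F" unfolding F_def using G by (intro finite_large_letters) auto
      have *: "\<forall>\<^sub>F k' in nhds k. g m k' \<in> G e"
        if "m \<in> F \<inter> {m. m \<notin> set (labs (snd k)) \<and> (\<exists>s. m \<in> set (labs s))}" for m
      proof -
        have "g m k = e" using g_e[of m _ "snd k" "fst k"] that k by auto
        then show ?thesis using G by (intro g_open) auto
      qed
      have "\<forall>\<^sub>F k' in nhds k. \<forall>m\<in>F \<inter> {m. m \<notin> set (labs (snd k)) \<and> (\<exists>s. m \<in> set (labs s))}. g m k' \<in> G e"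
        using \<open>finite F\<close> * by (intro eventually_ball_finite) auto
      moreover have "\<forall>\<^sub>F k' in nhds k. \<forall>m\<in>set (labs (snd k)). g m k' \<in> G (g m k)"
        using G by (intro eventually_ball_finite ballI g_open) (auto simp: f_def)
      moreover have "\<forall>\<^sub>F k' in nhds k.
          fits (- set (labs (snd k))) (map (\<lambda>m. {m}) (labs (snd k))) (labs (snd k'))"
        by (rule eventually_compose_filterlim[OF ev_labs_fits]) (intro tendsto_intros filterlim_ident)
      ultimately have "\<forall>\<^sub>F k' in nhds k. fits (G e) (map G (f k)) (f k')"
      proof eventually_elim
        case (elim k')
        have "fits (G e) (map (\<lambda>m. G (g m k)) (labs (snd k))) (map (\<lambda>m. g m k') (labs (snd k')))"
        proof (rule fits_map[OF elim(3)])
          fix m assume m: "m \<in> - set (labs (snd k))" "m \<in> set (labs (snd k'))"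
          show "g m k' \<in> G e"
          proof (cases "m \<in> F")
            case True
            then show ?thesis using elim(1) m by blast
          next
            case False
            then show ?thesis by (simp add: F_def g_def)
          qed
        qed (use elim in auto)
        then show ?case by (simp add: f_def o_def)
      qed
      then obtain S where "open S" "k \<in> S" "\<And>k'. k' \<in> S \<Longrightarrow> fits (G e) (map G (f k)) (f k')"
        unfolding eventually_nhds by blast
      then show "\<exists>T. openin (prod_topology (top_of_set {0..1}) (top_of_set {0..1})) T \<and> k \<in> T \<and>
          (\<forall>k'\<in>T. fits (G e) (map G (f k)) (f k'))"
        using k by (intro exI[of _ "({0..1} \<times> {0..1}) \<inter> S"]) (auto intro: openin_open_Int)
    qed
  next
    fix t
    have "f (0, t) = w t" by (simp add: f_def g_def map_letter_labs)
    moreover have "filter (\<lambda>x. x \<noteq> e) (w t) = w t" using letters[of t] by (auto simp: filter_id_conv)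
    ultimately show "filter (\<lambda>x. x \<noteq> e) (f (0, t)) = w t" by simp
  next
    fix t
    have in_ab: "t \<in> {a m<..<b m}" if m: "m \<in> set (labs t)" "g m (1, t) \<noteq> e" for m
    proof (rule ccontr)
      assume "t \<notin> {a m<..<b m}"
      then have "c m t \<notin> {0<..<1}" using c0[OF m(1)] c1[OF m(1)] by fastforce
      then have "g m (1, t) = e" by (simp add: g_def letter_not_alive labs_outside)
      with m show False by simp
    qed
    have "length (filter (\<lambda>x. x \<noteq> e) (f (1, t))) = length (filter (\<lambda>m. g m (1, t) \<noteq> e) (labs t))"
      by (simp add: f_def filter_map o_def)
    also have "\<dots> = card {m \<in> set (labs t). g m (1, t) \<noteq> e}"
      using distinct_labs[of t] by (simp add: distinct_length_filter Int_def conj_commute)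
    also have "\<dots> \<le> Suc 0"
    proof (subst card_le_Suc0_iff_eq)
      show "\<forall>m\<in>{m \<in> set (labs t). g m (1, t) \<noteq> e}. \<forall>m'\<in>{m \<in> set (labs t). g m (1, t) \<noteq> e}. m = m'"
        using in_ab disj by blast
    qed simp
    finally show "length (filter (\<lambda>x. x \<noteq> e) (f (1, t))) \<le> 1" by simp
  next
    fix r t :: real assume "t \<notin> {0<..<1}"
    then show "filter (\<lambda>x. x \<noteq> e) (f (r, t)) = []" by (simp add: f_def labs_outside)
  qed
qed

end

lemma loop_james_homotopic_sigma:
  assumes H: "Hausdorff_space X" and e: "e \<in> topspace X" and \<gamma>: "loopin (james X e) [] \<gamma>"
  obtains b where "loopin X e b" "path_homotopic (james X e) \<gamma> (james_sigma e \<circ> b)"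
proof -
  define w where "w t = \<gamma> (max 0 (min 1 t))" for t :: real
  have c\<gamma>: "continuous_map (top_of_set {0..1}) (james X e) \<gamma>" and \<gamma>01: "\<gamma> 0 = []" "\<gamma> 1 = []"
    using \<gamma> by (auto simp: loopin_def pathin_def)
  have w_eq: "w t = \<gamma> t" if "t \<in> {0..1}" for t using that by (simp add: w_def)
  have clamp: "continuous_map euclideanreal (top_of_set {0..1}) (\<lambda>t. max 0 (min 1 t))"
    by (auto simp: continuous_map_in_subtopology intro!: continuous_intros)
  have cw: "continuous_map euclideanreal (james X e) w"
    using continuous_map_compose[OF clamp c\<gamma>] by (simp add: w_def[abs_def] o_def)
  have "compactin (james X e) (\<gamma> ` {0..1})"
    by (rule image_compactin[OF _ c\<gamma>]) (simp add: compactin_subtopology)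
  then obtain n where n: "\<And>v. v \<in> \<gamma> ` {0..1} \<Longrightarrow> length v \<le> n"
    using compactin_james_bounded_length[OF H] by blast
  have words: "set (w t) \<subseteq> topspace X - {e}" for t
    using cw by (auto simp: continuous_map_def topspace_james james_words_def)
  have "\<forall>t. \<exists>U V. openin X U \<and> e \<in> U \<and> openin X V \<and> set (w t) \<subseteq> V \<and> U \<inter> V = {}"
  proof
    fix t
    have "compactin X {e}" "compactin X (set (w t))" "disjnt {e} (set (w t))"
      using e words[of t] by (auto intro!: finite_imp_compactin)
    then obtain U V where "openin X U" "openin X V" "{e} \<subseteq> U" "set (w t) \<subseteq> V" "disjnt U V"
      by (rule Hausdorff_space_compact_separation[OF H])
    then show "\<exists>U V. openin X U \<and> e \<in> U \<and> openin X V \<and> set (w t) \<subseteq> V \<and> U \<inter> V = {}"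
      by (auto simp: disjnt_def)
  qed
  then obtain U V where UV: "\<And>t. openin X (U t) \<and> e \<in> U t \<and> openin X (V t) \<and> set (w t) \<subseteq> V t \<and> U t \<inter> V t = {}"
    by metis
  interpret james_path X e w n U V
  proof
    fix t :: real
    show "length (w t) \<le> n" unfolding w_def by (rule n) auto
    show "w t = []" if "t \<notin> {0<..<1}"
    proof -
      from that have "max 0 (min 1 t) = 0 \<or> max 0 (min 1 t) = 1" by auto
      then show ?thesis unfolding w_def using \<gamma>01 by metis
    qed
  qed (use e cw UV in auto)
  obtain h :: "real \<times> real \<Rightarrow> 'a list"
    where h: "continuous_map (prod_topology (top_of_set {0..1}) (top_of_set {0..1})) (james X e) h"
    "\<forall>t. h (0, t) = w t" "\<forall>t. length (h (1, t)) \<le> 1" "\<forall>r t. t \<notin> {0<..<1} \<longrightarrow> h (r, t) = []"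
    by (rule homotopic_to_length_le_1)
  have "continuous_map (top_of_set {0..1}) (james X e) (h \<circ> Pair 1)"
    by (rule continuous_map_o_Pair[OF h(1)]) simp
  then obtain b where b: "continuous_map (top_of_set {0..1}) X b"
    and hb: "\<forall>t\<in>topspace (top_of_set {0..1}). (h \<circ> Pair 1) t = james_sigma e (b t)"
    by (rule continuous_map_james_length_le_1[OF e]) (use h(3) in auto)
  have "b 0 = e" "b 1 = e"
    using hb h(4) by (auto simp: james_sigma_def split: if_splits)
  then have "loopin X e b" using b by (simp add: loopin_def pathin_def)
  moreover have "path_homotopic (james X e) \<gamma> (james_sigma e \<circ> b)"
    unfolding path_homotopic_def
  proof (subst homotopic_with)
    show "\<exists>h. continuous_map (prod_topology (top_of_set {0..1::real}) (top_of_set {0..1::real})) (james X e) h \<and>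
        (\<forall>x\<in>topspace (top_of_set {0..1}). h (0, x) = \<gamma> x) \<and>
        (\<forall>x\<in>topspace (top_of_set {0..1}). h (1, x) = (james_sigma e \<circ> b) x) \<and>
        (\<forall>t\<in>{0..1}. h (t, 0) = \<gamma> 0 \<and> h (t, 1) = \<gamma> 1)"
      using h hb w_eq \<gamma>01 by (intro exI[of _ h]) auto
  qed auto
  ultimately show thesis by (rule that)
qed

lemma path_homotopic_sym: "path_homotopic Y f g \<Longrightarrow> path_homotopic Y g f"
  unfolding path_homotopic_def
  by (frule homotopic_with_imp_property) (auto dest: homotopic_with_symD)

lemma path_homotopic_trans: "path_homotopic Y f g \<Longrightarrow> path_homotopic Y g h \<Longrightarrow> path_homotopic Y f h"
  unfolding path_homotopic_def
  by (frule homotopic_with_imp_property) (auto dest: homotopic_with_trans)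

lemma path_homotopic_compose:
  "path_homotopic Y f g \<Longrightarrow> continuous_map Y Z k \<Longrightarrow> path_homotopic Z (k \<circ> f) (k \<circ> g)"
  unfolding path_homotopic_def
  by (erule homotopic_with_compose_continuous_map_left) auto

lemma pi1_map_class:
  assumes k: "continuous_map Y Z k" and g: "loopin Y a g"
  shows "pi1_map Z k a {h. loopin Y a h \<and> path_homotopic Y g h}
    = {h. loopin Z (k a) h \<and> path_homotopic Z (k \<circ> g) h}"
proof -
  have "path_homotopic Y g g" using g by (simp add: path_homotopic_def loopin_def pathin_def)
  then show ?thesis
    unfolding pi1_map_def using g path_homotopic_compose[OF _ k] path_homotopic_trans by blast
qed

theorem mainTheorem17:
  fixes X :: "'a topology" and e :: 'a
  assumes "path_connected_space X" and "Hausdorff_space X" and "e \<in> topspace X"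
  shows "pi1_map (james X e) (james_sigma e) e ` pi1 X e = pi1 (james X e) (james_sigma e e)"
proof -
  let ?J = "james X e" and ?\<sigma> = "james_sigma e"
  have \<sigma>: "continuous_map X ?J ?\<sigma>" using assms(3) by (rule continuous_map_james_sigma)
  have \<sigma>e: "?\<sigma> e = []" by (simp add: james_sigma_def)
  show ?thesis
  proof (intro equalityI subsetI)
    fix c assume "c \<in> pi1_map ?J ?\<sigma> e ` pi1 X e"
    then obtain g where g: "loopin X e g"
      and c: "c = {h. loopin ?J (?\<sigma> e) h \<and> path_homotopic ?J (?\<sigma> \<circ> g) h}"
      unfolding pi1_def using pi1_map_class[OF \<sigma>] by auto
    have "loopin ?J (?\<sigma> e) (?\<sigma> \<circ> g)"
      using g continuous_map_compose[OF _ \<sigma>] by (auto simp: loopin_def pathin_def)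
    with c show "c \<in> pi1 ?J (?\<sigma> e)" unfolding pi1_def by blast
  next
    fix c assume "c \<in> pi1 ?J (?\<sigma> e)"
    then obtain \<gamma> where \<gamma>: "loopin ?J [] \<gamma>"
      and c: "c = {h. loopin ?J (?\<sigma> e) h \<and> path_homotopic ?J \<gamma> h}"
      unfolding pi1_def \<sigma>e by blast
    obtain b where b: "loopin X e b" "path_homotopic ?J \<gamma> (?\<sigma> \<circ> b)"
      using loop_james_homotopic_sigma[OF assms(2,3) \<gamma>] by blast
    have "c = pi1_map ?J ?\<sigma> e {h. loopin X e h \<and> path_homotopic X b h}"
      unfolding pi1_map_class[OF \<sigma> b(1)] c
      using b(2) path_homotopic_sym path_homotopic_trans by blast
    moreover have "{h. loopin X e h \<and> path_homotopic X b h} \<in> pi1 X e"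
      unfolding pi1_def using b(1) by blast
    ultimately show "c \<in> pi1_map ?J ?\<sigma> e ` pi1 X e" by blast
  qed
qed

end
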